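(* Let $\Sigma_1=(G_1,\sigma_1)$ and $\Sigma_2=(G_2,\sigma_2)$ be two finite, simple, connected signed graphs and let $\Sigma_1\Box\Sigma_2$ be their Cartesian product. Then $$\operatorname{bdim}(\Sigma_1\Box\Sigma_2)=\begin{cases}\operatorname{bdim}(\Sigma_1), & \text{if } \Sigma_2 \text{ is balanced},\\ \operatorname{bdim}(\Sigma_2), & \text{if } \Sigma_1 \text{ is balanced}.\end{cases}$$
   Context: A signed graph $\Sigma=(G,\sigma)$ is a graph $G=(V,E)$ with a function $\sigma:E\to\{+1,-1\}$. All graphs are finite, simple, connected and undirected unless otherwise mentioned. The sign of a cycle is the product of the signs of its edges; $\Sigma$ is balanced if it has no cycle of sign $-1$. Let $\Omega=\{-1,0,1\}$, with $\Omega^k\subset\mathbb{R}^k$ carrying the standard inner product $\langle\cdot,\cdot\rangle$. A vector valued switching function ($k$-switching function) for $\Sigma$ is a map $\zeta:V\to\Omega^k$ with $\langle\zeta(u),\zeta(v)\rangle\neq 0$ for every edge $uv\in E$; the switched signed graph $\Sigma^\zeta=(G,\sigma^\zeta)$ has $\sigma^\zeta(uv)=\sigma(uv)\operatorname{sgn}(\langle\zeta(u),\zeta(v)\rangle)$. The balancing dimension $\operatorname{bdim}(\Sigma)$ is the least integer $k\ge 1$ for which there is a $k$-switching function $\zeta:V\to\Omega^k$ such that $\Sigma^\zeta$ is all-positive (every edge has sign $+1$). The Cartesian product $\Sigma_1\Box\Sigma_2$ is the Cartesian product $G_1\Box G_2$ of the underlying graphs, with signature $\sigma((u_i,v_j)(u_k,v_l))=\sigma_1(u_iu_k)$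 if $j=l$, and $=\sigma_2(v_jv_l)$ if $i=k$. *)

theory Defs
  imports Complex_Main "HOL-Library.FuncSet"
begin

text \<open>
  An undirected edge \<open>uv\<close> is represented by the two pairs \<open>(u, v)\<close> and \<open>(v, u)\<close>, on which the
  signature agrees. The value of \<open>sign\<close> at a non-edge is irrelevant.
\<close>

record 'a sgraph =
  verts :: "'a set"
  edges :: "('a \<times> 'a) set"
  sign :: "'a \<Rightarrow> 'a \<Rightarrow> real"

text \<open>Finite simple signed graphs; the vertex set is nonempty, as usual in graph theory.\<close>

definition signed_graph :: "'a sgraph \<Rightarrow> bool" where
  "signed_graph S \<longleftrightarrow>
     finite (verts S) \<and> verts S \<noteq> {} \<and>
     edges S \<subseteq> verts S \<times> verts S \<and> sym (edges S) \<and> irrefl (edges S) \<and>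
     (\<forall>(u, v) \<in> edges S. sign S u v \<in> {1, -1} \<and> sign S v u = sign S u v)"

definition graph_connected :: "'a sgraph \<Rightarrow> bool" where
  "graph_connected S \<longleftrightarrow> (\<forall>u \<in> verts S. \<forall>v \<in> verts S. (u, v) \<in> (edges S)\<^sup>*)"

text \<open>A cycle is given by the list of its distinct vertices; the last one is joined to the first.\<close>

definition is_cycle :: "'a sgraph \<Rightarrow> 'a list \<Rightarrow> bool" where
  "is_cycle S c \<longleftrightarrow> length c \<ge> 3 \<and> distinct c \<and>
     (\<forall>i < length c. (c ! i, c ! (Suc i mod length c)) \<in> edges S)"

definition cycle_sign :: "'a sgraph \<Rightarrow> 'a list \<Rightarrow> real" where
  "cycle_sign S c = (\<Prod>i < length c. sign S (c ! i) (c ! (Suc i mod length c)))"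

definition balanced :: "'a sgraph \<Rightarrow> bool" where
  "balanced S \<longleftrightarrow> \<not> (\<exists>c. is_cycle S c \<and> cycle_sign S c = -1)"

text \<open>
  Since \<open>k\<close> is quantified over in the balancing dimension, vectors of length \<open>k\<close> are functions on
  \<open>{..<k}\<close>, so that \<open>Omega k\<close> consists of the vectors with entries \<open>-1, 0, 1\<close>.
\<close>

definition Omega :: "nat \<Rightarrow> (nat \<Rightarrow> real) set" where
  "Omega k = {..<k} \<rightarrow>\<^sub>E {-1, 0, 1}"

definition inner_prod :: "nat \<Rightarrow> (nat \<Rightarrow> real) \<Rightarrow> (nat \<Rightarrow> real) \<Rightarrow> real" where
  "inner_prod k x y = (\<Sum>i<k. x i * y i)"

definition switching_function :: "'a sgraph \<Rightarrow> nat \<Rightarrow> ('a \<Rightarrow> nat \<Rightarrow> real) \<Rightarrow> bool" where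
  "switching_function S k \<zeta> \<longleftrightarrow>
     \<zeta> \<in> verts S \<rightarrow> Omega k \<and> (\<forall>(u, v) \<in> edges S. inner_prod k (\<zeta> u) (\<zeta> v) \<noteq> 0)"

definition switched :: "nat \<Rightarrow> ('a \<Rightarrow> nat \<Rightarrow> real) \<Rightarrow> 'a sgraph \<Rightarrow> 'a sgraph" where
  "switched k \<zeta> S = S\<lparr>sign := \<lambda>u v. sign S u v * sgn (inner_prod k (\<zeta> u) (\<zeta> v))\<rparr>"

definition all_positive :: "'a sgraph \<Rightarrow> bool" where
  "all_positive S \<longleftrightarrow> (\<forall>(u, v) \<in> edges S. sign S u v = 1)"

definition balancing_in :: "'a sgraph \<Rightarrow> nat \<Rightarrow> bool" where
  "balancing_in S k \<longleftrightarrow> (\<exists>\<zeta>. switching_function S k \<zeta> \<and> all_positive (switched k \<zeta> S))"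

definition bdim :: "'a sgraph \<Rightarrow> nat" where
  "bdim S = (LEAST k. k \<ge> 1 \<and> balancing_in S k)"

definition cart_prod :: "'a sgraph \<Rightarrow> 'b sgraph \<Rightarrow> ('a \<times> 'b) sgraph" where
  "cart_prod S T =
     \<lparr>verts = verts S \<times> verts T,
      edges = {((u, v), (u', v')). (v = v' \<and> v \<in> verts T \<and> (u, u') \<in> edges S) \<or>
                                   (u = u' \<and> u \<in> verts S \<and> (v, v') \<in> edges T)},
      sign = \<lambda>(u, v) (u', v'). if v = v' then sign S u u' else sign T v v'\<rparr>"

text \<open>The minimum defining \<open>bdim\<close> is attained: use one coordinate for each edge.\<close>

lemma balancing_in_exists:
  assumes "signed_graph S"
  shows "\<exists>k \<ge> 1. balancing_in S k"
proof -
  let ?V = "verts S" and ?E = "edges S"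
  have fin: "finite ?V" and sub: "?E \<subseteq> ?V \<times> ?V" and sy: "sym ?E" and irr: "irrefl ?E"
    and sg: "\<And>u v. (u, v) \<in> ?E \<Longrightarrow> sign S u v \<in> {1, -1} \<and> sign S v u = sign S u v"
    using assms unfolding signed_graph_def by auto
  obtain num :: "'a \<Rightarrow> nat" where num: "inj_on num ?V"
    using finite_imp_inj_to_nat_seg[OF fin] by blast
  define F where "F = {(u, v). (u, v) \<in> ?E \<and> num u < num v}"
  have "finite F"
    by (rule finite_subset[of _ "?V \<times> ?V"]) (use sub fin in \<open>auto simp: F_def\<close>)
  then obtain e where e: "bij_betw e {..<card F} F"
    using ex_bij_betw_nat_finite[of F] by (auto simp: atLeast0LessThan)
  define k where "k = Suc (card F)"
  define z where "z w = (\<lambda>i. if i < card F then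
      (if w = fst (e i) then 1 else if w = snd (e i) then sign S (fst (e i)) w else 0)
      else if i = card F then 0 else undefined)" for w
  have eF: "e i \<in> F" if "i < card F" for i
    using e that by (auto simp: bij_betw_def)
  have ip: "inner_prod k (z u) (z v) = sign S u v" if uv: "(u, v) \<in> F" for u v
  proof -
    obtain j where j: "j < card F" "e j = (u, v)"
      using e uv by (metis bij_betw_def imageE lessThan_iff)
    have ne: "u \<noteq> v" using uv by (auto simp: F_def)
    have other: "z u i * z v i = 0" if i: "i < k" "i \<noteq> j" for i
    proof (cases "i < card F")
      case True
      have "e i \<noteq> (u, v)"
        using e j i True by (metis bij_betw_def inj_on_eq_iff lessThan_iff)
      moreover have "e i \<noteq> (v, u)"
        using eF[OF True] uv by (auto simp: F_def)
      ultimately show ?thesis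
        using True ne by (cases "e i") (auto simp: z_def)
    next
      case False
      then show ?thesis using i by (auto simp: z_def k_def)
    qed
    have "inner_prod k (z u) (z v) = (\<Sum>i\<in>{j}. z u i * z v i)"
      unfolding inner_prod_def
      by (rule sum.mono_neutral_right) (use j other in \<open>auto simp: k_def\<close>)
    also have "\<dots> = sign S u v"
      using j ne by (simp add: z_def)
    finally show ?thesis .
  qed
  have ipE: "inner_prod k (z u) (z v) = sign S u v" if uv: "(u, v) \<in> ?E" for u v
  proof -
    have "u \<noteq> v" using uv irr by (auto simp: irrefl_def)
    then have "num u \<noteq> num v" using num uv sub by (auto simp: inj_on_eq_iff)
    moreover have "(v, u) \<in> ?E" using uv sy by (auto dest: symD)
    ultimately have "(u, v) \<in> F \<or> (v, u) \<in> F" using uv by (auto simp: F_def)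
    moreover have "inner_prod k (z u) (z v) = inner_prod k (z v) (z u)"
      by (simp add: inner_prod_def mult.commute)
    ultimately show ?thesis using ip sg[OF uv] by metis
  qed
  have Om: "z w \<in> Omega k" for w
  proof -
    have "z w i \<in> {-1, 0, 1}" if "i < k" for i
      using eF[of i] sg[of "fst (e i)" "snd (e i)"] that
      by (auto simp: z_def k_def F_def)
    moreover have "z w i = undefined" if "\<not> i < k" for i
      using that by (auto simp: z_def k_def)
    ultimately show ?thesis unfolding Omega_def by (intro PiE_I) auto
  qed
  have "switching_function S k z"
    unfolding switching_function_def using Om ipE sg by fastforce
  moreover have "all_positive (switched k z S)"
    unfolding all_positive_def switched_def using ipE sg by fastforce
  ultimately have "balancing_in S k" unfolding balancing_in_def by blast
  then show ?thesis by (intro exI[of _ k]) (simp add: k_def)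
qed

lemma signed_graph_cart_prod:
  assumes "signed_graph S" "signed_graph T"
  shows "signed_graph (cart_prod S T)"
  using assms unfolding signed_graph_def cart_prod_def sym_def irrefl_def
  by (auto split: if_splits)

end

theory Submission imports Defs begin

text \<open>
  Connected balanced graphs are exactly those whose signature has the form \<open>s u * s v\<close> with \<open>s\<close>
  valued in \<open>{1, -1}\<close> (Harary). If \<open>s\<close> is such a function for \<open>T\<close> and \<open>\<zeta>\<close> balances \<open>S\<close>, then
  \<open>(u, v) \<mapsto> s v * \<zeta> u\<close> balances the product in the same dimension, provided that \<open>\<zeta> u\<close> is
  never \<open>0\<close>; this can fail only at isolated vertices, where \<open>\<zeta>\<close> may be changed freely.
  Conversely, a balancing function of the product restricts to any copy of \<open>S\<close>.
\<close>

section \<open>Walks as vertex lists and their signs\<close>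

fun walk_sign :: "'a sgraph \<Rightarrow> 'a list \<Rightarrow> real" where
  "walk_sign S (x # y # p) = sign S x y * walk_sign S (y # p)"
| "walk_sign S _ = 1"

abbreviation walk :: "'a sgraph \<Rightarrow> 'a list \<Rightarrow> bool" where
  "walk S \<equiv> successively (\<lambda>u v. (u, v) \<in> edges S)"

lemma edge_sym:
  "signed_graph S \<Longrightarrow> (u, v) \<in> edges S \<Longrightarrow> (v, u) \<in> edges S"
  by (auto simp: signed_graph_def dest: symD)

lemma edge_irrefl:
  "signed_graph S \<Longrightarrow> (u, u) \<notin> edges S"
  by (auto simp: signed_graph_def irrefl_def)

lemma edge_verts:
  "signed_graph S \<Longrightarrow> (u, v) \<in> edges S \<Longrightarrow> u \<in> verts S \<and> v \<in> verts S"
  by (auto simp: signed_graph_def)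

lemma sign_edge:
  "signed_graph S \<Longrightarrow> (u, v) \<in> edges S \<Longrightarrow> sign S u v \<in> {1, -1}"
  by (auto simp: signed_graph_def)

lemma sign_commute:
  "signed_graph S \<Longrightarrow> (u, v) \<in> edges S \<Longrightarrow> sign S v u = sign S u v"
  by (auto simp: signed_graph_def)

text \<open>The vertex \<open>y\<close> is kept in both factors: the edge entering it belongs to the
  first, the edge leaving it to the second, so no edge is lost at the cut.\<close>

lemma walk_sign_append:
  "walk_sign S (xs @ y # ys) = walk_sign S (xs @ [y]) * walk_sign S (y # ys)"
proof (induction xs)
  case (Cons x xs)
  then show ?case by (cases xs) auto
qed simp

text \<open>Bridge to \<open>cycle_sign\<close>, which is an indexed product.\<close>

lemma walk_sign_conv_prod:
  "walk_sign S p = (\<Prod>i < length p - 1. sign S (p ! i) (p ! Suc i))"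
proof (induction S p rule: walk_sign.induct)
  case (1 S x y p)
  then show ?case by (simp add: prod.lessThan_Suc_shift del: prod.lessThan_Suc)
qed auto

lemma walk_sign_cases:
  assumes "signed_graph S" "walk S p"
  shows "walk_sign S p \<in> {1, -1}"
  using assms
proof (induction S p rule: walk_sign.induct)
  case (1 S x y p)
  then show ?case using sign_edge[of S x y] by auto
qed auto

lemma walk_sign_rev:
  assumes "signed_graph S" "walk S p"
  shows "walk_sign S (rev p) = walk_sign S p"
  using assms
proof (induction S p rule: walk_sign.induct)
  case (1 S x y p)
  have "walk_sign S (rev (x # y # p)) = walk_sign S (rev (y # p)) * sign S y x"
    using walk_sign_append[of S "rev p" y "[x]"] by simp
  then show ?case using 1 sign_commute[of S x y] by simp
qed auto

lemma walk_rev: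
  assumes "signed_graph S" "walk S p"
  shows "walk S (rev p)"
  unfolding successively_rev using assms(2) edge_sym[OF assms(1)]
  by (rule successively_mono)

section \<open>Closed walks in balanced graphs\<close>

text \<open>The cyclic successor used by \<open>is_cycle\<close> becomes the ordinary successor once
  the first vertex is repeated at the end.\<close>

lemma nth_append_hd:
  assumes "i < length c"
  shows "(c @ [hd c]) ! Suc i = c ! (Suc i mod length c)"
proof (cases "Suc i = length c")
  case True
  then show ?thesis using assms by (cases c) (auto simp: nth_append)
next
  case False
  then show ?thesis using assms by (auto simp: nth_append)
qed

text \<open>With at least three vertices this is a cycle, so balance applies. With two vertices the
  same edge is run through in both directions and its sign gets squared; one vertex would need a
  loop.\<close>

lemma walk_sign_distinct_closed:
  assumes S: "signed_graph S" and bal: "balanced S"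
    and c: "distinct c" "c \<noteq> []" and w: "walk S (c @ [hd c])"
  shows "walk_sign S (c @ [hd c]) = 1"
proof (cases "length c \<ge> 3")
  case True
  have nth: "(c @ [hd c]) ! i = c ! i" if "i < length c" for i
    using that by (simp add: nth_append)
  have "is_cycle S c"
    unfolding is_cycle_def
  proof (intro conjI allI impI)
    fix i assume i: "i < length c"
    then have "((c @ [hd c]) ! i, (c @ [hd c]) ! Suc i) \<in> edges S"
      using w unfolding successively_conv_nth by simp
    then show "(c ! i, c ! (Suc i mod length c)) \<in> edges S"
      by (simp only: nth[OF i] nth_append_hd[OF i])
  qed (use True c in auto)
  then have "cycle_sign S c \<noteq> -1" using bal by (auto simp: balanced_def)
  moreover have "walk_sign S (c @ [hd c]) = cycle_sign S c"
    unfolding walk_sign_conv_prod cycle_sign_def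
    by (intro prod.cong) (simp_all add: nth nth_append_hd del: nth_append)
  ultimately show ?thesis using walk_sign_cases[OF S w] by auto
next
  case False
  then consider x where "c = [x]" | x y where "c = [x, y]"
    using c(2) by (cases c rule: remdups_adj.cases; cases "tl (tl c)") auto
  then show ?thesis
  proof cases
    case 1
    then show ?thesis using w edge_irrefl[OF S] by auto
  next
    case 2
    then have e: "(x, y) \<in> edges S" using w by simp
    show ?thesis using 2 sign_edge[OF S e] sign_commute[OF S e] by auto
  qed
qed

text \<open>Strong induction on the length. At a repeated vertex the walk splits into two shorter
  closed walks, and the sign is the product of theirs.\<close>

lemma walk_sign_closed:
  assumes S: "signed_graph S" and bal: "balanced S"
    and "walk S p" "p \<noteq> []" "hd p = last p"
  shows "walk_sign S p = 1"
  using assms(3-)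
proof (induction "length p" arbitrary: p rule: less_induct)
  case less
  \<comment> \<open>Dropping the last vertex removes the trivial repetition of the start, so that a
    repetition within \<open>c\<close> is a proper one.\<close>
  obtain c x where p: "p = c @ [x]" using less.prems by (metis append_butlast_last_id)
  consider "c = []" | "c \<noteq> []" "distinct c" | "\<not> distinct c" by blast
  then show ?case
  proof cases
    case 1
    then show ?thesis using p by simp
  next
    case 2
    have "p = c @ [hd c]" using p less.prems 2 by simp
    then show ?thesis
      using walk_sign_distinct_closed[OF S bal 2(2,1)] less.prems(1) by simp
  next
    case 3
    then obtain xs ys zs y where c: "c = xs @ [y] @ ys @ [y] @ zs"
      using not_distinct_decomp by blast
    have p: "p = xs @ y # ys @ y # zs @ [x]"
      using p c by simp
    have w: "walk S (y # ys @ [y])" "walk S (xs @ y # zs @ [x])"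
      using less.prems(1) unfolding p
      by (auto simp: successively_append_iff successively_Cons hd_append split: if_splits)
    have "walk_sign S (y # ys @ [y]) = 1"
      using less.hyps[of "y # ys @ [y]"] w by (simp add: p)
    \<comment> \<open>Cutting out the loop at \<open>y\<close> keeps the walk closed, even for empty
      \<open>xs\<close>, where \<open>y\<close> itself is the start.\<close>
    moreover have "hd (xs @ y # zs @ [x]) = x"
      using less.prems by (cases xs) (auto simp: p)
    then have "walk_sign S (xs @ y # zs @ [x]) = 1"
      using less.hyps[of "xs @ y # zs @ [x]"] w by (simp add: p)
    moreover have "walk_sign S p =
        walk_sign S (xs @ [y]) * (walk_sign S (y # ys @ [y]) * walk_sign S (y # zs @ [x]))"
      unfolding p using walk_sign_append[of S xs y "ys @ y # zs @ [x]"]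
        walk_sign_append[of S "y # ys" y "zs @ [x]"] by simp
    ultimately show ?thesis using walk_sign_append[of S xs y "zs @ [x]"] by simp
  qed
qed

section \<open>Harary's form of a balanced signature\<close>

lemma rtrancl_imp_walk:
  assumes "(u, v) \<in> (edges S)\<^sup>*"
  shows "\<exists>p. walk S p \<and> p \<noteq> [] \<and> hd p = u \<and> last p = v"
  using assms
proof (induction rule: rtrancl_induct)
  case base
  show ?case by (rule exI[of _ "[u]"]) simp
next
  case (step v w)
  then obtain p where "walk S p" "p \<noteq> []" "hd p = u" "last p = v" by blast
  then show ?case
    using step by (intro exI[of _ "p @ [w]"]) (auto simp: successively_append_iff)
qed

text \<open>Take for \<open>s v\<close> the sign of a chosen walk from a root \<open>r\<close> to
  \<open>v\<close>. An edge \<open>uv\<close> closes the walks to \<open>u\<close> and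
  \<open>v\<close> into a closed walk, whose sign is 1.\<close>

lemma balanced_imp_sign_eq_mult:
  assumes S: "signed_graph S" and con: "graph_connected S" and bal: "balanced S"
  obtains s :: "'a \<Rightarrow> real" where "\<And>v. s v \<in> {1, -1}"
    and "\<And>u v. (u, v) \<in> edges S \<Longrightarrow> sign S u v = s u * s v"
proof -
  obtain r where r: "r \<in> verts S" using S by (auto simp: signed_graph_def)
  have "\<exists>p. walk S p \<and> p \<noteq> [] \<and> hd p = r \<and> last p = v" if "v \<in> verts S" for v
    using con r that by (intro rtrancl_imp_walk) (auto simp: graph_connected_def)
  then obtain P where P: "walk S (P v)" "P v \<noteq> []" "hd (P v) = r" "last (P v) = v"
    if "v \<in> verts S" for v by metis
  \<comment> \<open>The value 1 off the vertex set makes \<open>s\<close> valued in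
    \<open>{1, -1}\<close> everywhere.\<close>
  define s where "s v = (if v \<in> verts S then walk_sign S (P v) else 1)" for v
  have s: "s v \<in> {1, -1}" for v
    using walk_sign_cases[OF S] P by (simp add: s_def)
  have "sign S u v = s u * s v" if e: "(u, v) \<in> edges S" for u v
  proof -
    have uv: "u \<in> verts S" "v \<in> verts S" using edge_verts[OF S e] by auto
    note Pu = P[OF uv(1)] and Pv = P[OF uv(2)]
    obtain p where p: "P u = p @ [u]" using Pu by (metis append_butlast_last_id)
    obtain q where q: "rev (P v) = v # q"
      using Pv by (metis hd_Cons_tl hd_rev rev_is_Nil_conv)
    \<comment> \<open>From \<open>r\<close> to \<open>u\<close>, across the edge to
      \<open>v\<close>, and back to \<open>r\<close>.\<close>
    have "walk S (P u @ rev (P v))"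
      using Pu Pv e walk_rev[OF S Pv(1)] by (auto simp: successively_append_iff hd_rev)
    then have "walk_sign S (P u @ rev (P v)) = 1"
      using Pu Pv by (intro walk_sign_closed[OF S bal]) (auto simp: last_rev)
    moreover have "walk_sign S (P u @ rev (P v)) =
        walk_sign S (P u) * (sign S u v * walk_sign S (rev (P v)))"
      using walk_sign_append[of S p u "v # q"] by (simp add: p q)
    ultimately have "s u * (sign S u v * s v) = 1"
      using walk_sign_rev[OF S Pv(1)] uv by (simp add: s_def)
    then show ?thesis using s[of u] s[of v] by auto
  qed
  with s that show thesis by blast
qed

section \<open>Balancing functions without zero vectors\<close>

text \<open>Since edge signs are 1 or -1, a product of signs equals 1 exactly when the two agree,
  and agreement already forces a nonzero inner product.\<close>

lemma balancing_in_iff: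
  assumes "signed_graph S"
  shows "balancing_in S k \<longleftrightarrow> (\<exists>\<zeta>. \<zeta> \<in> verts S \<rightarrow> Omega k \<and>
    (\<forall>(u, v) \<in> edges S. sgn (inner_prod k (\<zeta> u) (\<zeta> v)) = sign S u v))"
proof -
  have "inner_prod k (\<zeta> u) (\<zeta> v) \<noteq> 0 \<and> sign S u v * sgn (inner_prod k (\<zeta> u) (\<zeta> v)) = 1 \<longleftrightarrow>
      sgn (inner_prod k (\<zeta> u) (\<zeta> v)) = sign S u v" if "(u, v) \<in> edges S" for \<zeta> u v
    using sign_edge[OF assms that] by (auto simp: sgn_if)
  then show ?thesis
    unfolding balancing_in_def switching_function_def all_positive_def switched_def
    by (simp add: Ball_def) meson
qed

lemma inner_prod_self_pos:
  assumes "inner_prod k x y \<noteq> 0"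
  shows "inner_prod k x x > 0"
proof -
  have "\<exists>i<k. x i \<noteq> 0"
  proof (rule ccontr)
    assume "\<not> (\<exists>i<k. x i \<noteq> 0)"
    then have "inner_prod k x y = 0" by (simp add: inner_prod_def)
    with assms show False by contradiction
  qed
  then obtain i where i: "i < k" "x i \<noteq> 0" by blast
  have "0 < x i * x i" using i(2) by (simp add: zero_less_mult_iff neq_iff) linarith
  also have "\<dots> \<le> inner_prod k x x"
    unfolding inner_prod_def using i(1) by (intro member_le_sum) auto
  finally show ?thesis .
qed

lemma balancing_in_nonzero:
  assumes S: "signed_graph S" and "balancing_in S k" "k \<ge> 1"
  obtains \<zeta> where "\<zeta> \<in> verts S \<rightarrow> Omega k"
    "\<And>u v. (u, v) \<in> edges S \<Longrightarrow> sgn (inner_prod k (\<zeta> u) (\<zeta> v)) = sign S u v"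
    "\<And>u. inner_prod k (\<zeta> u) (\<zeta> u) > 0"
proof -
  obtain z where z: "z \<in> verts S \<rightarrow> Omega k"
    "\<And>u v. (u, v) \<in> edges S \<Longrightarrow> sgn (inner_prod k (z u) (z v)) = sign S u v"
    using assms(2) balancing_in_iff[OF S] by blast
  \<comment> \<open>Outside \<open>Domain (edges S)\<close> no edge condition constrains the vector;
    the all-ones vector is nonzero because \<open>k \<ge> 1\<close>. At an edge the inner product
    with the neighbour already excludes zero.\<close>
  define \<zeta> where "\<zeta> u = (if u \<in> Domain (edges S) then z u else (\<lambda>i\<in>{..<k}. 1))" for u
  have "\<zeta> \<in> verts S \<rightarrow> Omega k"
    using z(1) by (auto simp: \<zeta>_def Omega_def Pi_iff)
  moreover have "sgn (inner_prod k (\<zeta> u) (\<zeta> v)) = sign S u v" if e: "(u, v) \<in> edges S" for u v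
    using z(2)[OF e] e edge_sym[OF S e] by (auto simp: \<zeta>_def)
  moreover have "inner_prod k (\<zeta> u) (\<zeta> u) > 0" for u
  proof (cases "u \<in> Domain (edges S)")
    case True
    then obtain v where e: "(u, v) \<in> edges S" by blast
    then have "inner_prod k (z u) (z v) \<noteq> 0"
      using z(2)[OF e] sign_edge[OF S e] by auto
    then show ?thesis using inner_prod_self_pos True by (auto simp: \<zeta>_def)
  next
    case False
    then show ?thesis using assms(3) by (auto simp: \<zeta>_def inner_prod_def)
  qed
  ultimately show thesis using that by blast
qed

section \<open>Balancing functions of Cartesian products\<close>

lemma balancing_in_cart_prod_left:
  assumes S: "signed_graph S" and T: "signed_graph T" and bal: "balancing_in (cart_prod S T) k"
  shows "balancing_in S k"
proof -
  \<comment> \<open>The fibre over \<open>v\<close> is the copy of \<open>S\<close> to which the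
    function is restricted.\<close>
  obtain v where v: "v \<in> verts T" using T by (auto simp: signed_graph_def)
  obtain \<zeta> where "\<zeta> \<in> verts (cart_prod S T) \<rightarrow> Omega k"
    "\<forall>(a, b) \<in> edges (cart_prod S T). sgn (inner_prod k (\<zeta> a) (\<zeta> b)) = sign (cart_prod S T) a b"
    using bal S T by (auto simp: balancing_in_iff signed_graph_cart_prod)
  then show ?thesis
    unfolding balancing_in_iff[OF S] using v
    by (intro exI[of _ "\<lambda>u. \<zeta> (u, v)"]) (fastforce simp: cart_prod_def)
qed

lemma balancing_in_cart_prod_balanced:
  assumes S: "signed_graph S" and T: "signed_graph T"
    and con: "graph_connected T" and bal: "balanced T"
    and k: "balancing_in S k" "k \<ge> 1"
  shows "balancing_in (cart_prod S T) k"
proof -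
  obtain s :: "'b \<Rightarrow> real" where s: "\<And>v. s v \<in> {1, -1}"
    "\<And>u v. (u, v) \<in> edges T \<Longrightarrow> sign T u v = s u * s v"
    using balanced_imp_sign_eq_mult[OF T con bal] by blast
  obtain \<zeta> where \<zeta>: "\<zeta> \<in> verts S \<rightarrow> Omega k"
    "\<And>u v. (u, v) \<in> edges S \<Longrightarrow> sgn (inner_prod k (\<zeta> u) (\<zeta> v)) = sign S u v"
    "\<And>u. inner_prod k (\<zeta> u) (\<zeta> u) > 0"
    using balancing_in_nonzero[OF S k] by blast
  \<comment> \<open>Restriction to \<open>{..<k}\<close> keeps the vectors extensional, as
    \<open>Omega\<close> demands.\<close>
  define z where "z = (\<lambda>(u, v). \<lambda>i\<in>{..<k}. s v * \<zeta> u i)"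
  have ip: "inner_prod k (z (u, v)) (z (u', v')) = s v * s v' * inner_prod k (\<zeta> u) (\<zeta> u')"
    for u v u' v'
    by (simp add: z_def inner_prod_def sum_distrib_left algebra_simps)
  have sgn_s: "sgn (s v) = s v" "s v * s v = 1" for v using s(1)[of v] by auto
  have "z \<in> verts (cart_prod S T) \<rightarrow> Omega k"
  proof
    fix a assume "a \<in> verts (cart_prod S T)"
    then obtain u v where a: "a = (u, v)" "u \<in> verts S" by (auto simp: cart_prod_def)
    then have "\<zeta> u i \<in> {-1, 0, 1}" if "i < k" for i
      using \<zeta>(1) that by (auto simp: Omega_def Pi_iff PiE_iff)
    then have "s v * \<zeta> u i \<in> {-1, 0, 1}" if "i < k" for i
      using s(1)[of v] that by fastforce
    then show "z a \<in> Omega k" by (auto simp: z_def a Omega_def)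
  qed
  \<comment> \<open>Along an edge of \<open>S\<close> the factor is \<open>s v * s v = 1\<close>.
    Along an edge of \<open>T\<close> the inner product is \<open>s v * s v'\<close> times the
    positive square norm of \<open>\<zeta> u\<close>; there \<open>v\<close> and \<open>v'\<close>
    differ, so the product signature takes its value from \<open>T\<close>.\<close>
  moreover have "sgn (inner_prod k (z a) (z b)) = sign (cart_prod S T) a b"
    if "(a, b) \<in> edges (cart_prod S T)" for a b
    using that edge_irrefl[OF T]
    by (cases a; cases b)
      (auto simp: cart_prod_def ip sgn_mult sgn_s \<zeta> s(2) sgn_pos)
  ultimately show ?thesis
    using balancing_in_iff[OF signed_graph_cart_prod[OF S T]] by blast
qed

text \<open>For every \<open>k \<ge> 1\<close> the product and \<open>S\<close> are balanced in
  dimension \<open>k\<close> simultaneously, so the two minima range over the same set.\<close>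

lemma bdim_cart_prod_balanced:
  assumes "signed_graph S" "signed_graph T" "graph_connected T" "balanced T"
  shows "bdim (cart_prod S T) = bdim S"
  unfolding bdim_def
  using balancing_in_cart_prod_left[OF assms(1,2)] balancing_in_cart_prod_balanced[OF assms]
  by (intro arg_cong[where f = Least] ext) blast

lemma balancing_in_cart_prod_swap:
  assumes S: "signed_graph S" and T: "signed_graph T" and bal: "balancing_in (cart_prod S T) k"
  shows "balancing_in (cart_prod T S) k"
proof -
  obtain \<zeta> where \<zeta>: "\<zeta> \<in> verts (cart_prod S T) \<rightarrow> Omega k"
    "\<And>a b. (a, b) \<in> edges (cart_prod S T) \<Longrightarrow>
      sgn (inner_prod k (\<zeta> a) (\<zeta> b)) = sign (cart_prod S T) a b"
    using bal balancing_in_iff[OF signed_graph_cart_prod[OF S T]] by blast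
  have "\<zeta> \<circ> prod.swap \<in> verts (cart_prod T S) \<rightarrow> Omega k"
    using \<zeta>(1) by (auto simp: cart_prod_def)
  moreover have "sgn (inner_prod k ((\<zeta> \<circ> prod.swap) a) ((\<zeta> \<circ> prod.swap) b)) =
      sign (cart_prod T S) a b" if e: "(a, b) \<in> edges (cart_prod T S)" for a b
  proof -
    have "(prod.swap a, prod.swap b) \<in> edges (cart_prod S T)"
      using e by (auto simp: cart_prod_def)
    \<comment> \<open>The signature of the product tests only second coordinates. Since there are no
      loops, an edge changes exactly one coordinate, so swapping consistently exchanges the two
      branches.\<close>
    moreover have "sign (cart_prod S T) (prod.swap a) (prod.swap b) = sign (cart_prod T S) a b"
      using e edge_irrefl[OF S] edge_irrefl[OF T] by (auto simp: cart_prod_def)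
    ultimately show ?thesis using \<zeta>(2) by simp
  qed
  ultimately show ?thesis
    using balancing_in_iff[OF signed_graph_cart_prod[OF T S]] by blast
qed

text \<open>Reduces the case of a balanced first factor to that of a balanced second factor.\<close>

lemma bdim_cart_prod_commute:
  assumes "signed_graph S" "signed_graph T"
  shows "bdim (cart_prod S T) = bdim (cart_prod T S)"
  unfolding bdim_def
  using balancing_in_cart_prod_swap[OF assms] balancing_in_cart_prod_swap[OF assms(2,1)]
  by (intro arg_cong[where f = Least] ext) blast

theorem theorem2p2:
  fixes S1 :: "'a sgraph" and S2 :: "'b sgraph"
  assumes "signed_graph S1" and "graph_connected S1"
    and "signed_graph S2" and "graph_connected S2"
  shows "(balanced S2 \<longrightarrow> bdim (cart_prod S1 S2) = bdim S1) \<and>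
         (balanced S1 \<longrightarrow> bdim (cart_prod S1 S2) = bdim S2)"
  using assms by (metis bdim_cart_prod_balanced bdim_cart_prod_commute)

end
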